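(* Over the space $\mathcal{S}$ of star-shaped regions centered at the origin, the topology generated by the Hausdorff metric $H$ is not finer than the topology generated by the symmetric-difference metric $V$; and for every Mulholland function $\psi$, the topology generated by $H$ is not finer than the topology generated by the Wasserstein metric $W^\psi$.
   Context: Fix $n\ge 2$; $\mathbb{E}^n$ is $n$-dimensional Euclidean space with distance $d$ and a chosen origin; $v$ is $n$-dimensional volume. A region is a nonempty bounded open subset of $\mathbb{E}^n$ equal to the interior of its closure. $\mathcal{S}$ is the set of all regions that are star-shaped with respect to the origin. "Finer" is meant in the non-strict sense (finer than or equal to); "not finer" is its negation. For a point $p$ and region $Q$, $d(p,Q)=\min_{q\in\bar Q}d(p,q)$; $H^1(P,Q)=\sup_{p\in P}d(p,Q)$; the Hausdorff metric is $H(P,Q)=\max(H^1(P,Q),H^1(Q,P))$. The symmetric-difference metric is $V(P,Q)=v((P\setminus Q)\cup(Q\setminus P))$. Mulholland function: a continuous, (strictly) increasing $\psi:\mathbb{R}^{\ge0}\to\mathbb{R}^{\ge0}$ with $\psi(0)=0$, $\lim_{x\to\infty}\psi(x)=\infty$, and $\psi^{-1}(\sum_{i=1}^m\psi(x_i+y_i))\le\psi^{-1}(\sum_{i=1}^m\psi(x_i))+\psi^{-1}(\sum_{i=1}^m\psi(y_i))$ for all $m$ and all $x_i,y_i\ge0$. Wasserstein metric: for a region $P$ let $U_P$ be the uniform probability distribution on $P$. For regions $P,Q$, $W^\psi(P,Q)=\inf_\gamma\psi^{-1}\left(\frac{1}{v(P)}\int_P\psi(d(x,\gamma(x)))\,dx\right)$,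 the infimum over all (measurable) functions $\gamma$ such that if a random variable $X$ has distribution $U_P$ then $\gamma(X)$ has distribution $U_Q$. *)

theory Defs
  imports "HOL-Probability.Probability"
begin

definition region :: "'a::euclidean_space set \<Rightarrow> bool" where
  "region P \<longleftrightarrow> P \<noteq> {} \<and> bounded P \<and> open P \<and> P = interior (closure P)"

(* This is the library's starlike with the centre fixed to be the origin. *)
definition star_shaped_at_origin :: "'a::euclidean_space set \<Rightarrow> bool" where
  "star_shaped_at_origin P \<longleftrightarrow> 0 \<in> P \<and> (\<forall>x\<in>P. closed_segment 0 x \<subseteq> P)"

definition star_regions :: "'a::euclidean_space set set" where
  "star_regions = {P. region P \<and> star_shaped_at_origin P}"

(* infdist p (closure Q) is the minimum of dist p q over the compact set closure Q. *)
definition Hausdorff1 :: "'a::euclidean_space set \<Rightarrow> 'a set \<Rightarrow> real" where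
  "Hausdorff1 P Q = (SUP p\<in>P. infdist p (closure Q))"

definition Hausdorff_dist :: "'a::euclidean_space set \<Rightarrow> 'a set \<Rightarrow> real" where
  "Hausdorff_dist P Q = max (Hausdorff1 P Q) (Hausdorff1 Q P)"

definition sym_diff_dist :: "'a::euclidean_space set \<Rightarrow> 'a set \<Rightarrow> real" where
  "sym_diff_dist P Q = measure lborel ((P - Q) \<union> (Q - P))"

(* psi is a function on the nonnegative reals: its values at negative arguments are junk. *)
definition psi_inv :: "(real \<Rightarrow> real) \<Rightarrow> real \<Rightarrow> real" where
  "psi_inv \<psi> = inv_into {0..} \<psi>"

definition Mulholland :: "(real \<Rightarrow> real) \<Rightarrow> bool" where
  "Mulholland \<psi> \<longleftrightarrow>
     continuous_on {0..} \<psi> \<and> strict_mono_on {0..} \<psi> \<and> \<psi> 0 = 0 \<and>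
     filterlim \<psi> at_top at_top \<and>
     (\<forall>(m::nat) (x::nat \<Rightarrow> real) (y::nat \<Rightarrow> real).
        (\<forall>i\<in>{1..m}. 0 \<le> x i \<and> 0 \<le> y i) \<longrightarrow>
        psi_inv \<psi> (\<Sum>i=1..m. \<psi> (x i + y i))
          \<le> psi_inv \<psi> (\<Sum>i=1..m. \<psi> (x i)) + psi_inv \<psi> (\<Sum>i=1..m. \<psi> (y i)))"

(* Maps are total Borel functions; only their restriction to P matters, and every Borel
   function on P extends to one on the whole space. *)
definition transport_maps :: "'a::euclidean_space set \<Rightarrow> 'a set \<Rightarrow> ('a \<Rightarrow> 'a) set" where
  "transport_maps P Q =
     {\<gamma> \<in> borel_measurable borel.
        distr (uniform_measure lborel P) borel \<gamma> = uniform_measure lborel Q}"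

(* A transport map sends almost every point of P into the bounded set Q, so for regions P, Q
   and a Mulholland function the integrand is essentially bounded and the Bochner integral
   is the genuine one.  The costs are bounded below by 0, and transport maps between regions
   exist because uniform distributions have no atoms, so the infimum is the genuine one too. *)
definition Wasserstein_dist ::
    "(real \<Rightarrow> real) \<Rightarrow> 'a::euclidean_space set \<Rightarrow> 'a set \<Rightarrow> real" where
  "Wasserstein_dist \<psi> P Q =
     (INF \<gamma>\<in>transport_maps P Q.
        psi_inv \<psi> ((1 / measure lborel P) * (LINT x:P|lborel. \<psi> (dist x (\<gamma> x)))))"

(* The library's Metric_space.mtopology can be unfolded only after d has been shown to be a
   metric, symmetric and nonnegative even outside S.  This is the same construction for an
   arbitrary distance function; the lemmas below give its open sets and its agreement with
   the library. *)
definition dist_topology :: "'b set \<Rightarrow> ('b \<Rightarrow> 'b \<Rightarrow> real) \<Rightarrow> 'b topology" where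
  "dist_topology S d =
     topology (\<lambda>U. U \<subseteq> S \<and> (\<forall>x\<in>U. \<exists>r>0. \<forall>y\<in>S. d x y < r \<longrightarrow> y \<in> U))"

lemma openin_dist_topology:
  "openin (dist_topology S d) U \<longleftrightarrow>
     U \<subseteq> S \<and> (\<forall>x\<in>U. \<exists>r>0. \<forall>y\<in>S. d x y < r \<longrightarrow> y \<in> U)"
proof -
  have "istopology (\<lambda>U. U \<subseteq> S \<and> (\<forall>x\<in>U. \<exists>r>0. \<forall>y\<in>S. d x y < r \<longrightarrow> y \<in> U))"
    unfolding istopology_def
  proof (rule conjI; intro allI impI)
    fix U V assume U: "U \<subseteq> S \<and> (\<forall>x\<in>U. \<exists>r>0. \<forall>y\<in>S. d x y < r \<longrightarrow> y \<in> U)"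
      and V: "V \<subseteq> S \<and> (\<forall>x\<in>V. \<exists>r>0. \<forall>y\<in>S. d x y < r \<longrightarrow> y \<in> V)"
    show "U \<inter> V \<subseteq> S \<and> (\<forall>x\<in>U \<inter> V. \<exists>r>0. \<forall>y\<in>S. d x y < r \<longrightarrow> y \<in> U \<inter> V)"
    proof (intro conjI ballI)
      fix x assume "x \<in> U \<inter> V"
      then obtain r s where "r > 0" "\<forall>y\<in>S. d x y < r \<longrightarrow> y \<in> U"
        "s > 0" "\<forall>y\<in>S. d x y < s \<longrightarrow> y \<in> V" using U V by blast
      then show "\<exists>r>0. \<forall>y\<in>S. d x y < r \<longrightarrow> y \<in> U \<inter> V"
        by (intro exI[of _ "min r s"]) auto
    qed (use U in auto)
  next
    fix K assume "\<forall>U\<in>K. U \<subseteq> S \<and> (\<forall>x\<in>U. \<exists>r>0. \<forall>y\<in>S. d x y < r \<longrightarrow> y \<in> U)"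
    then show "\<Union>K \<subseteq> S \<and> (\<forall>x\<in>\<Union>K. \<exists>r>0. \<forall>y\<in>S. d x y < r \<longrightarrow> y \<in> \<Union>K)"
      by (meson UnionE UnionI Union_least)
  qed
  then show ?thesis
    unfolding dist_topology_def by (simp add: topology_inverse')
qed

lemma topspace_dist_topology: "topspace (dist_topology S d) = S"
proof -
  have "openin (dist_topology S d) S"
    unfolding openin_dist_topology by (auto intro: exI[of _ 1])
  then show ?thesis
    unfolding topspace_def using openin_dist_topology[of S d] by blast
qed

lemma dist_topology_eq_mtopology:
  assumes "Metric_space S d"
  shows "dist_topology S d = Metric_space.mtopology S d"
proof -
  interpret Metric_space S d by fact
  have "openin (dist_topology S d) U = openin mtopology U" for U
    unfolding openin_dist_topology openin_mtopology subset_iff in_mball by blast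
  then show ?thesis
    by (simp add: topology_eq)
qed

(* Non-strict: X is finer than or equal to Y. *)
definition finer_than :: "'b topology \<Rightarrow> 'b topology \<Rightarrow> bool" where
  "finer_than X Y \<longleftrightarrow> (\<forall>U. openin Y U \<longrightarrow> openin X U)"

end

theory Submission
  imports Defs
begin

text \<open>
  Let B be the unit ball.  The ball of radius 1/2 together with a thin neighbourhood of the segments
  from 0 to the points of a finite net of B is Hausdorff-close to B.  In dimension at least 2 these
  segments are null sets, so almost all the mass of such a spiky region lies in the ball of radius
  1/2.  Hence the region stays away from B in symmetric difference.  For the Wasserstein distances,
  the mean of a bounded Lipschitz function w over the uniform distribution is continuous: by
  \<open>w x - w y \<le> \<epsilon> + \<psi> (dist x y) / \<psi> \<epsilon>\<close> a cheap transport map changes it little.  Taking for w a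
  function supported outside the ball of radius 1/2 gives a set that is Wasserstein-open and contains
  B but no sufficiently spiky region.
\<close>

section \<open>Borel coding of points by real numbers\<close>

text \<open>For a number whose base 4 digits are all 0 or 1, the parity of the floor reads off a digit.\<close>

definition parity_digit :: "nat \<Rightarrow> real \<Rightarrow> bool" where
  "parity_digit j t \<longleftrightarrow> odd \<lfloor>4 ^ j * t\<rfloor>"

definition bit_code :: "(nat \<Rightarrow> bool) \<Rightarrow> real" where
  "bit_code s = (\<Sum>j. of_bool (s j) * (1 / 4) ^ j)"

lemma summable_bit_code: "summable (\<lambda>j. of_bool (s j) * (1 / 4 :: real) ^ j)"
  by (rule summable_comparison_test'[of "\<lambda>j. (1 / 4 :: real) ^ j" 0])
    (auto intro!: summable_geometric)

lemma bit_code_bounds: "0 \<le> bit_code s" "bit_code s \<le> 4 / 3"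
proof -
  show "0 \<le> bit_code s"
    unfolding bit_code_def by (rule suminf_nonneg[OF summable_bit_code]) auto
  have "bit_code s \<le> (\<Sum>j. (1 / 4 :: real) ^ j)"
    unfolding bit_code_def
    by (rule suminf_le[OF _ summable_bit_code]) (auto intro!: summable_geometric)
  also have "\<dots> = 4 / 3"
    by (subst suminf_geometric) auto
  finally show "bit_code s \<le> 4 / 3" .
qed

lemma bit_code_Suc: "bit_code s = of_bool (s 0) + bit_code (\<lambda>j. s (Suc j)) / 4"
proof -
  have "bit_code s = of_bool (s 0) + (\<Sum>j. of_bool (s (Suc j)) * (1 / 4) ^ Suc j)"
    unfolding bit_code_def by (subst suminf_split_head[OF summable_bit_code]) auto
  also have "(\<Sum>j. of_bool (s (Suc j)) * (1 / 4 :: real) ^ Suc j)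
      = (\<Sum>j. of_bool (s (Suc j)) * (1 / 4) ^ j / 4)"
    by (simp add: field_simps)
  also have "\<dots> = bit_code (\<lambda>j. s (Suc j)) / 4"
    unfolding bit_code_def by (rule suminf_divide[OF summable_bit_code])
  finally show ?thesis .
qed

lemma parity_digit_bit_code: "parity_digit j (bit_code s) \<longleftrightarrow> s j"
proof -
  \<comment> \<open>Multiplying by \<open>4 ^ j\<close> makes each digit before position
    \<open>j\<close> contribute a multiple of 4, and digit \<open>j\<close> becomes the units
    digit.\<close>
  have "\<exists>k::int. 4 ^ j * bit_code s = 4 * of_int k + bit_code (\<lambda>i. s (j + i))"
  proof (induction j)
    case 0
    then show ?case by (auto intro: exI[of _ 0])
  next
    case (Suc j)
    then obtain k :: int where k: "4 ^ j * bit_code s = 4 * of_int k + bit_code (\<lambda>i. s (j + i))"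
      by blast
    have "4 ^ Suc j * bit_code s = 4 * of_int (4 * k + of_bool (s j)) + bit_code (\<lambda>i. s (Suc j + i))"
      using k bit_code_Suc[of "\<lambda>i. s (j + i)"] by (simp add: algebra_simps)
    then show ?case by blast
  qed
  then obtain k :: int where "4 ^ j * bit_code s = 4 * of_int k + bit_code (\<lambda>i. s (j + i))"
    by blast
  then have *: "4 ^ j * bit_code s = of_int (4 * k + of_bool (s j)) + bit_code (\<lambda>i. s (Suc (j + i))) / 4"
    using bit_code_Suc[of "\<lambda>i. s (j + i)"] by simp
  \<comment> \<open>The remaining tail lies between 0 and (4/3)/4 = 1/3, so the floor removes it;
    the multiple of 4 does not affect the parity.\<close>
  have "\<lfloor>4 ^ j * bit_code s\<rfloor> = 4 * k + of_bool (s j)"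
    unfolding * using bit_code_bounds[of "\<lambda>i. s (Suc (j + i))"] by linarith
  then show ?thesis
    unfolding parity_digit_def by simp
qed

lemma measurable_parity_digit[measurable]: "Measurable.pred borel (parity_digit j)"
  unfolding parity_digit_def by measurable

text \<open>A point is coded by the sequence of bits telling in which balls of radius 1/(m+1) around the
  points of a countable dense set it lies.  The sequence is written in base 4, where digits 0 and 1
  leave no ambiguity, and the point is the limit of the first listed centres.\<close>

lemma borel_retract_of_real:
  obtains \<phi> :: "'a::euclidean_space \<Rightarrow> real" and \<rho> :: "real \<Rightarrow> 'a"
  where "\<phi> \<in> borel_measurable borel" "\<rho> \<in> borel_measurable borel" "\<And>x. \<rho> (\<phi> x) = x"
proof -
  obtain D0 :: "'a set" where D0: "countable D0" "\<And>X. open X \<Longrightarrow> X \<noteq> {} \<Longrightarrow> \<exists>d\<in>D0. d \<in> X"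
    using countable_dense_setE by blast
  define D where "D = from_nat_into D0"
  have "D0 \<noteq> {}" using D0(2)[of UNIV] by auto
  then have range_D: "range D = D0"
    unfolding D_def using D0(1) by (rule range_from_nat_into)
  define s where "s x j = (case prod_decode j of (i, m) \<Rightarrow> dist x (D i) < 1 / real (Suc m))" for x j
  define \<phi> where "\<phi> x = bit_code (s x)" for x
  \<comment> \<open>For a \<open>t\<close> that is not a code, the \<open>LEAST\<close> here and the
    \<open>lim\<close> below may be arbitrary values; correctness matters only at
    \<open>\<phi> x\<close>.\<close>
  define \<rho>' where "\<rho>' m t = D (LEAST i. parity_digit (prod_encode (i, m)) t)" for m t
  define \<rho> where "\<rho> t = lim (\<lambda>m. \<rho>' m t)" for t
  show thesis
  proof
    have [measurable]: "Measurable.pred borel (\<lambda>x. s x j)" for j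
      unfolding s_def by (cases "prod_decode j") simp
    show "\<phi> \<in> borel_measurable borel"
      unfolding \<phi>_def bit_code_def by measurable
    have [measurable]: "\<rho>' m \<in> borel_measurable borel" for m
      unfolding \<rho>'_def by measurable
    show "\<rho> \<in> borel_measurable borel"
      unfolding \<rho>_def by measurable
    fix x
    have bit: "parity_digit (prod_encode (i, m)) (\<phi> x) \<longleftrightarrow> dist x (D i) < 1 / real (Suc m)" for i m
      unfolding \<phi>_def parity_digit_bit_code s_def by simp
    have near: "dist (\<rho>' m (\<phi> x)) x < 1 / real (Suc m)" for m
    proof -
      obtain d where "d \<in> D0" "d \<in> ball x (1 / real (Suc m))"
        using D0(2)[of "ball x (1 / real (Suc m))"] by auto
      then obtain i where "dist x (D i) < 1 / real (Suc m)"
        using range_D by (metis mem_ball imageE)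
      then show ?thesis
        unfolding \<rho>'_def bit using LeastI[of "\<lambda>i. dist x (D i) < 1 / real (Suc m)" i]
        by (simp add: dist_commute)
    qed
    have "(\<lambda>m. \<rho>' m (\<phi> x)) \<longlonglongrightarrow> x"
    proof (rule tendsto_dist_iff[THEN iffD2], rule tendsto_sandwich[OF _ _ tendsto_const LIMSEQ_inverse_real_of_nat])
      show "\<forall>\<^sub>F m in sequentially. dist (\<rho>' m (\<phi> x)) x \<le> inverse (real (Suc m))"
        using near by (intro always_eventually allI less_imp_le) (simp add: inverse_eq_divide)
    qed simp
    then show "\<rho> (\<phi> x) = x"
      unfolding \<rho>_def by (rule limI)
  qed
qed

section \<open>Atomless distributions and transport\<close>

text \<open>The quantile \<open>I \<omega>\<close> is the least point where \<open>C\<close> reaches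
  \<open>\<omega>\<close>, so \<open>C\<close> is at most \<open>\<omega>\<close> to its left.
  Without atoms \<open>C\<close> is continuous, and the left limit gives the remaining
  inequality.\<close>

lemma (in cdf_distribution) cdf_quantile:
  assumes atomless: "\<And>x. measure M {x} = 0" and \<omega>: "0 < \<omega>" "\<omega> < 1"
  shows "C (I \<omega>) = \<omega>"
proof (rule antisym)
  show "\<omega> \<le> C (I \<omega>)"
    using pseudoinverse[OF \<omega>] by blast
  have "isCont C (I \<omega>)"
    by (simp add: isCont_cdf atomless)
  then have "(C \<longlongrightarrow> C (I \<omega>)) (at_left (I \<omega>))"
    using filterlim_at_split[of C _ "I \<omega>"] by (simp add: isCont_def)
  moreover have "\<forall>\<^sub>F y in at_left (I \<omega>). C y \<le> \<omega>"
  proof -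
    have "C y \<le> \<omega>" if "y < I \<omega>" for y
      using pseudoinverse[OF \<omega>, of y] that by linarith
    then show ?thesis
      by (auto simp: eventually_at_filter)
  qed
  ultimately show "C (I \<omega>) \<le> \<omega>"
    by (rule tendsto_upperbound) simp
qed

text \<open>The probability integral transform: \<open>M\<close> is the law of \<open>I\<close>
  under the uniform law on (0,1), and \<open>C \<circ> I\<close> is the identity there.\<close>

lemma (in cdf_distribution) distr_cdf_uniform:
  assumes "\<And>x. measure M {x} = 0"
  shows "distr M borel C = distr (restrict_space lborel {0<..<1}) borel (\<lambda>\<omega>. \<omega>)"
proof -
  let ?\<Omega> = "restrict_space lborel {0<..<1::real}"
  have "I \<in> measurable ?\<Omega> borel"
    using measurable_CI by (simp add: measurable_def space_restrict_space sets_restrict_space)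
  then have "distr (distr ?\<Omega> borel I) borel C = distr ?\<Omega> borel (\<lambda>\<omega>. C (I \<omega>))"
    by (subst distr_distr) (auto simp: o_def)
  also have "\<dots> = distr ?\<Omega> borel (\<lambda>\<omega>. \<omega>)"
    by (rule distr_cong) (auto simp: space_restrict_space cdf_quantile[OF assms])
  finally show ?thesis
    by (simp add: distr_I_eq_M)
qed

text \<open>The cdf of the atomless image of M turns M into the uniform distribution on (0,1), and the
  quantile function of the real code of N turns that into N.\<close>

lemma borel_transport_exists:
  fixes M N :: "'a::euclidean_space measure" and f :: "'a \<Rightarrow> real"
  assumes M: "prob_space M" "sets M = sets borel" and N: "prob_space N" "sets N = sets borel"
    and f: "f \<in> borel_measurable borel" and atomless: "\<And>t. measure M (f -` {t}) = 0"
  shows "\<exists>\<gamma> \<in> borel_measurable borel. distr M borel \<gamma> = N"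
proof -
  let ?\<Omega> = "restrict_space lborel {0<..<1::real}"
  obtain \<phi> :: "'a \<Rightarrow> real" and \<rho>
    where \<phi>: "\<phi> \<in> borel_measurable borel" and \<rho>: "\<rho> \<in> borel_measurable borel"
      and \<rho>\<phi>: "\<And>x. \<rho> (\<phi> x) = x"
    using borel_retract_of_real by blast
  have fM: "f \<in> borel_measurable M" and \<phi>N: "\<phi> \<in> borel_measurable N"
    using f \<phi> M(2) N(2) by (simp_all cong: measurable_cong_sets)
  interpret M: prob_space M by fact
  interpret N: prob_space N by fact
  interpret A: cdf_distribution "distr M borel f"
    unfolding cdf_distribution_def by (rule M.real_distribution_distr[OF fM])
  interpret B: cdf_distribution "distr N borel \<phi>"
    unfolding cdf_distribution_def by (rule N.real_distribution_distr[OF \<phi>N])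
  \<comment> \<open>The value 0 only makes the quantile function a total Borel map; the uniform law
    is carried by (0,1).\<close>
  define J where "J t = (if t \<in> {0<..<1} then B.I t else 0)" for t
  have J: "J \<in> borel_measurable borel"
    unfolding J_def
    using measurable_If_restrict_space_iff[of borel "\<lambda>t. t \<in> {0<..<1::real}" B.I "\<lambda>_. 0" borel] B.measurable_CI
    by (simp only: Collect_mem_eq) simp
  have \<rho>J: "(\<lambda>t. \<rho> (J t)) \<in> borel_measurable borel"
    using measurable_compose[OF J \<rho>] .
  have "measure (distr M borel f) {t} = 0" for t
  proof -
    have "f -` {t} \<inter> space M = f -` {t}"
      using sets_eq_imp_space_eq[OF M(2)] by simp
    then show ?thesis
      by (subst measure_distr[OF fM]) (simp_all add: atomless)
  qed
  then have unif: "distr (distr M borel f) borel A.C = distr ?\<Omega> borel (\<lambda>\<omega>. \<omega>)"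
    by (rule A.distr_cdf_uniform)
  define \<gamma> where "\<gamma> = (\<lambda>x. \<rho> (J (A.C (f x))))"
  have \<gamma>: "\<gamma> \<in> borel_measurable borel"
    unfolding \<gamma>_def by (rule measurable_compose[OF measurable_compose[OF f A.measurable_C] \<rho>J])
  have id: "(\<lambda>\<omega>. \<omega>) \<in> measurable ?\<Omega> borel"
    by (simp add: measurable_restrict_space1)
  have J\<Omega>: "J \<in> measurable ?\<Omega> borel"
    using J by (simp add: measurable_restrict_space1)
  have "distr M borel \<gamma> = distr (distr (distr M borel f) borel A.C) borel (\<lambda>t. \<rho> (J t))"
    using fM A.measurable_C \<rho>J measurable_compose[OF A.measurable_C \<rho>J]
    by (simp add: distr_distr o_def \<gamma>_def)
  also have "\<dots> = distr (distr ?\<Omega> borel J) borel \<rho>"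
    unfolding unif using id \<rho>J J\<Omega> \<rho> by (simp add: distr_distr o_def)
  also have "distr ?\<Omega> borel J = distr ?\<Omega> borel B.I"
    by (rule distr_cong) (auto simp: space_restrict_space J_def)
  also have "\<dots> = distr N borel \<phi>"
    by (rule B.distr_I_eq_M)
  also have "distr (distr N borel \<phi>) borel \<rho> = distr N borel (\<lambda>x. x)"
    using \<rho> \<phi>N by (simp add: distr_distr o_def \<rho>\<phi>)
  also have "\<dots> = N"
    by (rule distr_id2) (simp add: N(2))
  finally show ?thesis
    using \<gamma> by blast
qed

section \<open>Volumes and uniform distributions of regions\<close>

lemma emeasure_open_ne_0:
  fixes A :: "'a::euclidean_space set"
  assumes "open A" "A \<noteq> {}"
  shows "emeasure lborel A \<noteq> 0"
proof
  assume "emeasure lborel A = 0"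
  then have "A \<in> null_sets lborel"
    using assms(1) by (intro null_setsI) auto
  then have "negligible A"
    by (simp add: negligible_iff_null_sets null_sets_completionI)
  then show False
    using open_not_negligible assms by blast
qed

lemma measure_open_pos:
  fixes A :: "'a::euclidean_space set"
  assumes "open A" "bounded A" "A \<noteq> {}"
  shows "0 < measure lborel A"
  using emeasure_open_ne_0[OF assms(1,3)] emeasure_bounded_finite[OF assms(2)]
  by (simp add: measure_def enn2real_positive_iff zero_less_iff_neq_zero)

lemma region_emeasure:
  assumes "region P"
  shows "emeasure lborel P \<noteq> 0" "emeasure lborel P \<noteq> \<infinity>" "0 < measure lborel P" "P \<in> sets borel"
  using assms emeasure_bounded_finite[of P] unfolding region_def
  by (auto simp: emeasure_open_ne_0 measure_open_pos)

lemma prob_space_uniform_region: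
  "region P \<Longrightarrow> prob_space (uniform_measure lborel P)"
  by (rule prob_space_uniform_measure[OF region_emeasure(1,2)])

text \<open>Without transport maps the infimum in the Wasserstein distance would be a junk value.\<close>

lemma transport_maps_nonempty:
  fixes P Q :: "'a::euclidean_space set"
  assumes "region P" "region Q"
  shows "transport_maps P Q \<noteq> {}"
proof -
  obtain b :: 'a where b: "b \<in> Basis" by (rule exE[OF nonempty_Basis[unfolded ex_in_conv[symmetric]]])
  \<comment> \<open>The level sets of a coordinate are hyperplanes, hence null, so the coordinate
    has an atomless law under the uniform distribution.\<close>
  have "measure (uniform_measure lborel P) ((\<lambda>x. b \<bullet> x) -` {t}) = 0" for t
  proof -
    have "negligible {x. b \<bullet> x = t}"
      using b by (intro negligible_hyperplane) auto
    then have "{x. b \<bullet> x = t} \<in> null_sets lborel"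
      by (simp add: negligible_iff_null_sets null_sets_completion_iff)
    then have "P \<inter> {x. b \<bullet> x = t} \<in> null_sets lborel"
      using region_emeasure(4)[OF assms(1)] by (intro null_set_Int1) auto
    then show ?thesis
      using region_emeasure[OF assms(1)] by (simp add: vimage_def measure_def null_setsD1)
  qed
  then have "\<exists>\<gamma> \<in> borel_measurable borel. distr (uniform_measure lborel P) borel \<gamma> = uniform_measure lborel Q"
    by (intro borel_transport_exists[where f = "\<lambda>x. b \<bullet> x"] prob_space_uniform_region assms) auto
  then show ?thesis
    unfolding transport_maps_def by auto
qed

section \<open>Star-shaped regions with thin spikes\<close>

text \<open>A union of balls need not be the interior of its closure. Passing to that interior
  repairs this and preserves the star shape, since scaling by a positive factor maps open sets to
  open sets.\<close>

lemma star_regions_interior_closure: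
  fixes G :: "'a::euclidean_space set"
  assumes "open G" "bounded G" "0 \<in> G" and star: "\<And>x t. x \<in> G \<Longrightarrow> 0 \<le> t \<Longrightarrow> t \<le> 1 \<Longrightarrow> t *\<^sub>R x \<in> G"
  shows "interior (closure G) \<in> star_regions"
proof -
  let ?P = "interior (closure G)"
  have GP: "G \<subseteq> ?P"
    using \<open>open G\<close> closure_subset by (rule interior_maximal[rotated])
  have "closure ?P = closure G"
    by (metis GP closure_closure closure_mono interior_subset subset_antisym)
  then have "region ?P"
    unfolding region_def using assms(2,3) GP
    by (auto intro: bounded_subset[OF bounded_closure interior_subset])
  moreover have "t *\<^sub>R x \<in> ?P" if "x \<in> ?P" "0 \<le> t" "t \<le> 1" for x t
  \<comment> \<open>Scaling by 0 does not preserve openness, so this case rests on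
    \<open>0 \<in> G\<close> instead.\<close>
  proof (cases "t = 0")
    case True
    then show ?thesis using GP \<open>0 \<in> G\<close> by auto
  next
    case False
    have "(*\<^sub>R) t ` ?P \<subseteq> (*\<^sub>R) t ` closure G"
      using interior_subset by blast
    also have "\<dots> = closure ((*\<^sub>R) t ` G)"
      by (rule closure_scaleR)
    also have "\<dots> \<subseteq> closure G"
      using star that by (intro closure_mono) auto
    finally have "(*\<^sub>R) t ` ?P \<subseteq> ?P"
      using False by (intro interior_maximal open_scaling) auto
    then show ?thesis using that by auto
  qed
  ultimately show ?thesis
    unfolding star_regions_def star_shaped_at_origin_def closed_segment_def
    using GP \<open>0 \<in> G\<close> by auto
qed

lemma ball_in_star_regions:
  assumes "0 < r"
  shows "ball 0 r \<in> star_regions"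
proof -
  have "t *\<^sub>R x \<in> ball 0 r" if "x \<in> ball 0 r" "0 \<le> t" "t \<le> 1" for x :: 'a and t
    using that mult_right_mono[of t 1 "norm x"] by auto
  then have "interior (closure (ball (0::'a) r)) \<in> star_regions"
    using assms by (intro star_regions_interior_closure) auto
  then show ?thesis
    using assms by (simp add: interior_cball)
qed

lemma Hausdorff1_le:
  assumes "P \<noteq> {}" "\<And>p. p \<in> P \<Longrightarrow> \<exists>q\<in>closure Q. dist p q \<le> e"
  shows "Hausdorff1 P Q \<le> e"
  unfolding Hausdorff1_def
proof (rule cSUP_least[OF assms(1)])
  fix p assume "p \<in> P"
  then obtain q where "q \<in> closure Q" "dist p q \<le> e"
    using assms(2) by blast
  then show "infdist p (closure Q) \<le> e"
    by (rule infdist_le2)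
qed

text \<open>The dimension hypothesis does its work here: a segment from the origin spans a subspace
  of dimension at most 1, and proper subspaces are null.\<close>

lemma negligible_Union_segments:
  fixes Z :: "'a::euclidean_space set"
  assumes "2 \<le> DIM('a)" "finite Z"
  shows "negligible (\<Union>z\<in>Z. closed_segment 0 z)"
proof (rule negligible_Union)
  show "finite ((\<lambda>z. closed_segment 0 z) ` Z)"
    using assms by simp
  fix S assume "S \<in> (\<lambda>z. closed_segment 0 z) ` Z"
  then obtain z where S: "S = closed_segment 0 z" by blast
  have "S \<subseteq> span {z}"
    unfolding S closed_segment_def by (auto simp: span_base span_mul)
  then have "dim S \<le> card {z}"
    by (intro dim_le_card) auto
  then show "negligible S"
    using assms(1) by (intro negligible_lowdim) auto
qed

text \<open>Outer regularity gives an open superset of small measure; compactness fits a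
  neighbourhood of uniform radius inside it.\<close>

lemma null_compact_small_nbhd:
  fixes N :: "'a::euclidean_space set"
  assumes "negligible N" "compact N" "0 < e"
  obtains d where "0 < d" "(\<Union>x\<in>N. cball x d) \<in> sets borel"
    "emeasure lborel (\<Union>x\<in>N. cball x d) < ennreal e"
proof -
  have N: "N \<in> sets borel" "emeasure lborel N = 0"
  proof -
    show borel: "N \<in> sets borel"
      using assms(2) by (simp add: compact_imp_closed)
    then have "N \<in> null_sets lborel"
      using assms(1) by (simp add: negligible_iff_null_sets null_sets_completion_iff)
    then show "emeasure lborel N = 0" by auto
  qed
  obtain T where T: "open T" "N \<subseteq> T" "T - N \<in> lmeasurable" "emeasure lebesgue (T - N) < ennreal e"
    using sets_lebesgue_outer_open[of N e] N assms(3) by auto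
  have "emeasure lborel T = emeasure lborel (T - N)"
    using N T(1) by (subst emeasure_Diff_null_set) auto
  then have less: "emeasure lborel T < ennreal e"
    using T N by simp
  obtain d where d: "0 < d" "(\<Union>x\<in>N. cball x d) \<subseteq> T"
    using compact_subset_open_imp_cball_epsilon_subset[OF assms(2) T(1,2)] by blast
  \<comment> \<open>Written as the sum of a compact set and a closed ball, the neighbourhood is
    closed and therefore Borel.\<close>
  have "(\<Union>x\<in>N. cball x d) = (\<Union>x\<in>N. \<Union>y\<in>cball 0 d. {x + y})"
  proof (intro SUP_cong refl subset_antisym subsetI)
    fix x y :: 'a assume "y \<in> cball x d"
    then have "y - x \<in> cball 0 d" "y = x + (y - x)"
      by (auto simp: dist_norm norm_minus_commute)
    then show "y \<in> (\<Union>y\<in>cball 0 d. {x + y})" by blast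
  qed (auto simp: dist_norm)
  then have "closed (\<Union>x\<in>N. cball x d)"
    using compact_closed_sums[OF assms(2) closed_cball] by simp
  moreover have "emeasure lborel (\<Union>x\<in>N. cball x d) \<le> emeasure lborel T"
    using d(2) T(1) by (intro emeasure_mono) auto
  ultimately show thesis
    using d(1) less by (intro that[of d]) auto
qed

lemma spiky_star_region:
  fixes e :: real
  assumes dim: "2 \<le> DIM('a::euclidean_space)" and e: "0 < e"
  obtains Q :: "'a::euclidean_space set" where "Q \<in> star_regions" "Hausdorff_dist (ball 0 1) Q \<le> e"
    "ball 0 (1/2) \<subseteq> Q" "measure lborel (Q - cball 0 (1/2)) < e"
proof -
  \<comment> \<open>\<open>Z\<close> is a finite \<open>e\<close>-net of the closed unit ball; its
    points are the tips of the spikes.\<close>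
  obtain Z where Z: "finite Z" "Z \<subseteq> cball (0::'a) 1" "cball 0 1 \<subseteq> (\<Union>z\<in>Z. ball z e)"
  proof (rule compactE_image[OF compact_cball])
    show "cball (0::'a) 1 \<subseteq> (\<Union>z\<in>cball 0 1. ball z e)"
      using e by (force intro: UN_I)
  qed auto
  define N where "N = (\<Union>z\<in>Z. closed_segment 0 z)"
  have N: "negligible N" "compact N"
    unfolding N_def using negligible_Union_segments[OF dim Z(1)] Z(1) by (auto intro: compact_UN)
  have N1: "N \<subseteq> cball 0 1"
    unfolding N_def using Z(2) by (auto intro: closed_segment_subset[THEN subsetD, rotated -1])
  have Nscale: "t *\<^sub>R x \<in> N" if "x \<in> N" "0 \<le> t" "t \<le> 1" for x t
  proof -
    obtain z u where "z \<in> Z" "x = u *\<^sub>R z" "0 \<le> u" "u \<le> 1"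
      using \<open>x \<in> N\<close> unfolding N_def closed_segment_def by auto
    then show ?thesis
      unfolding N_def closed_segment_def using that(2,3)
      by (auto intro!: bexI[of _ z] exI[of _ "t * u"] mult_le_one)
  qed
  obtain d' where d': "0 < d'" "(\<Union>x\<in>N. cball x d') \<in> sets borel"
    "emeasure lborel (\<Union>x\<in>N. cball x d') < ennreal e"
    using null_compact_small_nbhd[OF N e] by blast
  \<comment> \<open>The closure of the open \<open>d\<close>-neighbourhood of \<open>N\<close> lies
    in the closed \<open>2 * d\<close>-neighbourhood. Halving fits the latter within
    \<open>d'\<close>, for the volume, and within \<open>e\<close>, for the Hausdorff
    distance.\<close>
  define d where "d = min d' e / 2"
  have d: "0 < d" "2 * d \<le> d'" "2 * d \<le> e"
    unfolding d_def using d' e by auto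
  define G where "G = ball 0 (1/2) \<union> (\<Union>x\<in>N. ball x d)"
  define Q where "Q = interior (closure G)"
  have "open G" unfolding G_def by auto
  then have GQ: "G \<subseteq> Q"
    unfolding Q_def using closure_subset by (rule interior_maximal[rotated])
  have closG: "closure G \<subseteq> cball 0 (1/2) \<union> (\<Union>x\<in>N. cball x (2 * d))"
  proof -
    have "y \<in> (\<Union>x\<in>N. cball x (2 * d))" if "y \<in> closure (\<Union>x\<in>N. ball x d)" for y
    proof -
      obtain y' where "y' \<in> (\<Union>x\<in>N. ball x d)" "dist y' y < d"
        using \<open>y \<in> closure (\<Union>x\<in>N. ball x d)\<close> d(1) closure_approachable by blast
      then obtain x where "x \<in> N" "dist x y' < d" by auto
      then show ?thesis
        using \<open>dist y' y < d\<close> dist_triangle[of x y y'] by (intro UN_I[of x]) auto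
    qed
    then show ?thesis
      unfolding G_def closure_Un by auto
  qed
  then have Qsub: "Q \<subseteq> cball 0 (1/2) \<union> (\<Union>x\<in>N. cball x (2 * d))"
    unfolding Q_def using interior_subset by blast
  show thesis
  proof
    show "ball 0 (1/2) \<subseteq> Q"
      using GQ unfolding G_def by auto
    have bdd: "bounded G"
    proof (rule bounded_subset)
      show "bounded (cball (0::'a) (1 + d))" by simp
      show "G \<subseteq> cball 0 (1 + d)"
      proof
        fix y assume "y \<in> G"
        then consider "norm y < 1/2" | x where "x \<in> N" "dist x y < d"
          unfolding G_def by auto
        then show "y \<in> cball 0 (1 + d)"
        proof cases
          case 2
          then show ?thesis
            using N1 norm_triangle_sub[of y x] by (auto simp: dist_norm norm_minus_commute)
        qed (use d in auto)
      qed
    qed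
    show "Q \<in> star_regions"
      unfolding Q_def
    proof (rule star_regions_interior_closure[OF \<open>open G\<close> bdd])
      show "0 \<in> G" unfolding G_def by auto
      fix y t assume y: "y \<in> G" and t: "0 \<le> t" "t \<le> (1::real)"
      have shrink: "t * r \<le> r" if "0 \<le> r" for r :: real
        using t that mult_right_mono[of t 1 r] by simp
      consider "norm y < 1/2" | x where "x \<in> N" "dist x y < d"
        using y unfolding G_def by auto
      then show "t *\<^sub>R y \<in> G"
      proof cases
        case 1
        then show ?thesis
          unfolding G_def using t shrink[of "norm y"] by auto
      next
        case 2
        \<comment> \<open>Shrinking towards the origin keeps \<open>x\<close> in \<open>N\<close>
          and does not increase its distance to \<open>y\<close>.\<close>
        have "dist (t *\<^sub>R x) (t *\<^sub>R y) = t * dist x y"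
          using t by (simp add: dist_norm flip: scaleR_diff_right)
        also have "\<dots> < d"
          using 2 shrink[of "dist x y"] by auto
        finally show ?thesis
          unfolding G_def using Nscale[OF 2(1) t] by auto
      qed
    qed
    show "Hausdorff_dist (ball 0 1) Q \<le> e"
      unfolding Hausdorff_dist_def
    proof (rule max.boundedI)
      show "Hausdorff1 (ball 0 1) Q \<le> e"
      proof (rule Hausdorff1_le)
        fix p :: 'a assume "p \<in> ball 0 1"
        then have "p \<in> (\<Union>z\<in>Z. ball z e)"
          by (intro subsetD[OF Z(3)]) auto
        then obtain z where "z \<in> Z" "dist z p < e"
          by auto
        \<comment> \<open>Net points are endpoints of the segments forming \<open>N\<close>, so the
          net property gives the distance bound.\<close>
        moreover have "z \<in> Q"
          using \<open>z \<in> Z\<close> d(1) GQ unfolding G_def N_def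
          by (meson UN_I UnI2 centre_in_ball ends_in_segment(2) subsetD)
        ultimately show "\<exists>q\<in>closure Q. dist p q \<le> e"
          using closure_subset by (intro bexI[of _ z]) (auto simp: dist_commute)
      qed auto
      show "Hausdorff1 Q (ball 0 1) \<le> e"
      proof (rule Hausdorff1_le)
        show "Q \<noteq> {}" using GQ unfolding G_def by auto
        fix p assume "p \<in> Q"
        then consider "norm p \<le> 1/2" | x where "x \<in> N" "dist x p \<le> 2 * d"
          using Qsub by auto
        then show "\<exists>q\<in>closure (ball 0 1). dist p q \<le> e"
        proof cases
          case 1
          then show ?thesis using e by (intro bexI[of _ p]) auto
        next
          case 2
          then show ?thesis using N1 d(3) by (intro bexI[of _ x]) (auto simp: dist_commute)
        qed
      qed
    qed
    \<comment> \<open>Outside the closed half ball, only the thin neighbourhood of the null set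
      \<open>N\<close> is left.\<close>
    have "emeasure lborel (Q - cball 0 (1/2)) \<le> emeasure lborel (\<Union>x\<in>N. cball x d')"
    proof (rule emeasure_mono)
      have "cball x (2 * d) \<subseteq> cball x d'" for x :: 'a
        using d(2) by (rule subset_cball)
      then show "Q - cball 0 (1/2) \<subseteq> (\<Union>x\<in>N. cball x d')"
        using Qsub by blast
    qed (simp add: d'(2))
    also have "\<dots> < ennreal e" by fact
    finally have less: "emeasure lborel (Q - cball 0 (1/2)) < ennreal e" .
    then have "emeasure lborel (Q - cball 0 (1/2)) = ennreal (measure lborel (Q - cball 0 (1/2)))"
      by (intro emeasure_eq_ennreal_measure) auto
    then show "measure lborel (Q - cball 0 (1/2)) < e"
      using less by (simp add: ennreal_less_iff)
  qed
qed

section \<open>Open sets for the symmetric-difference metric\<close>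

lemma region_if_star_region: "P \<in> star_regions \<Longrightarrow> region P"
  by (simp add: star_regions_def)

lemma ball_minus_cball_ne:
  assumes "0 \<le> r" "r < s"
  shows "ball (0::'a::euclidean_space) s - cball 0 r \<noteq> {}"
proof -
  obtain x :: 'a where "norm x = (r + s) / 2"
    using vector_choose_size[of "(r + s) / 2"] assms by auto
  then have "x \<in> ball 0 s - cball 0 r"
    using assms by auto
  then show ?thesis by blast
qed

lemma sym_diff_dist_triangle:
  assumes "region P" "region Q" "region R"
  shows "sym_diff_dist P R \<le> sym_diff_dist P Q + sym_diff_dist Q R"
proof -
  have "A \<in> fmeasurable lborel" "A \<in> sets borel" if "region A" for A :: "'a set"
    using region_emeasure(2,4)[OF that] by (auto intro!: fmeasurableI simp: less_top)
  note fm = this[OF assms(1)] this[OF assms(2)] this[OF assms(3)]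
  have "sym_diff_dist P R \<le> measure lborel ((P - Q \<union> (Q - P)) \<union> (Q - R \<union> (R - Q)))"
    unfolding sym_diff_dist_def using fm by (intro measure_mono_fmeasurable) (auto intro!: fmeasurable.Un fmeasurable.Diff)
  also have "\<dots> \<le> sym_diff_dist P Q + sym_diff_dist Q R"
    unfolding sym_diff_dist_def using fm by (intro measure_Un_le) auto
  finally show ?thesis .
qed

text \<open>\<open>dist_topology\<close> accepts any distance function, so that a ball is open has
  to come from the triangle inequality.\<close>

lemma openin_sym_diff_ball:
  assumes "P \<in> star_regions"
  shows "openin (dist_topology star_regions sym_diff_dist) {Q \<in> star_regions. sym_diff_dist P Q < r}"
  unfolding openin_dist_topology
proof safe
  fix Q assume Q: "Q \<in> star_regions" "sym_diff_dist P Q < r"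
  show "\<exists>s>0. \<forall>R\<in>star_regions. sym_diff_dist Q R < s \<longrightarrow>
      R \<in> {Q \<in> star_regions. sym_diff_dist P Q < r}"
  proof (intro exI[of _ "r - sym_diff_dist P Q"] conjI ballI impI)
    fix R assume "R \<in> star_regions" "sym_diff_dist Q R < r - sym_diff_dist P Q"
    then show "R \<in> {Q \<in> star_regions. sym_diff_dist P Q < r}"
      using sym_diff_dist_triangle[of P Q R] assms Q by (auto simp: region_if_star_region)
  qed (use Q in auto)
qed

section \<open>Wasserstein distance and means of Lipschitz functions\<close>

text \<open>Turns the normalised integral in \<open>Wasserstein_dist\<close> into an
  expectation.\<close>

lemma integral_uniform_measure_region:
  fixes f :: "'a::euclidean_space \<Rightarrow> real"
  assumes "region P" "f \<in> borel_measurable borel"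
  shows "integral\<^sup>L (uniform_measure lborel P) f = (1 / measure lborel P) * (LINT x:P|lborel. f x)"
proof -
  have "uniform_measure lborel P = density lborel (\<lambda>x. ennreal (indicator P x / measure lborel P))"
    unfolding uniform_measure_def
  proof (intro density_cong AE_I2)
    fix x
    have "emeasure lborel P = ennreal (measure lborel P)"
      using region_emeasure(2)[OF assms(1)] by (simp add: emeasure_eq_ennreal_measure)
    then show "indicator P x / emeasure lborel P = ennreal (indicator P x / measure lborel P)"
      using region_emeasure(3)[OF assms(1)] by (simp add: divide_ennreal flip: ennreal_indicator)
  qed (use region_emeasure(4)[OF assms(1)] in auto)
  then have "integral\<^sup>L (uniform_measure lborel P) f
      = (LINT x|lborel. (indicator P x / measure lborel P) *\<^sub>R f x)"
    using assms(2) region_emeasure(4)[OF assms(1)] by (simp add: integral_density)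
  also have "\<dots> = (LINT x|lborel. (1 / measure lborel P) * (indicator P x *\<^sub>R f x))"
    by (intro Bochner_Integration.integral_cong) auto
  also have "\<dots> = (1 / measure lborel P) * (LINT x:P|lborel. f x)"
    unfolding set_lebesgue_integral_def by (rule integral_mult_right_zero)
  finally show ?thesis .
qed

context
  fixes \<psi> :: "real \<Rightarrow> real"
  assumes Mulholland: "Mulholland \<psi>"
begin

lemma Mulholland_less_iff: "0 \<le> s \<Longrightarrow> 0 \<le> t \<Longrightarrow> \<psi> s < \<psi> t \<longleftrightarrow> s < t"
  using Mulholland unfolding Mulholland_def
  by (auto simp: strict_mono_on_less)

lemma Mulholland_nonneg: "0 \<le> t \<Longrightarrow> 0 \<le> \<psi> t"
  using Mulholland_less_iff[of t 0] Mulholland by (auto simp: Mulholland_def not_less[symmetric])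

text \<open>The intermediate value theorem applies because \<open>\<psi>\<close> starts at 0, is
  continuous and tends to infinity. Hence \<open>psi_inv \<psi>\<close> is a true right inverse on
  the nonnegative reals.\<close>

lemma Mulholland_surj:
  assumes "0 \<le> y"
  shows "y \<in> \<psi> ` {0..}"
proof -
  have lim: "filterlim \<psi> at_top at_top" and cont: "continuous_on {0..} \<psi>" and "\<psi> 0 = 0"
    using Mulholland by (auto simp: Mulholland_def)
  have "\<forall>\<^sub>F t in at_top. 0 \<le> t \<and> y \<le> \<psi> t"
    using eventually_ge_at_top[of 0] filterlim_at_top[THEN iffD1, OF lim, rule_format, of y]
    by (rule eventually_conj)
  then obtain t where t: "0 \<le> t" "y \<le> \<psi> t"
    unfolding eventually_at_top_linorder by blast
  have "\<exists>s. 0 \<le> s \<and> s \<le> t \<and> \<psi> s = y"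
    using t assms \<open>\<psi> 0 = 0\<close> by (intro IVT') (auto intro: continuous_on_subset[OF cont])
  then show ?thesis by auto
qed

lemma psi_inv_less_imp:
  assumes "0 \<le> y" "psi_inv \<psi> y < r"
  shows "y < \<psi> r"
proof -
  have "0 \<le> psi_inv \<psi> y" "\<psi> (psi_inv \<psi> y) = y"
    using Mulholland_surj[OF assms(1)] inv_into_into[of y \<psi> "{0..}"] unfolding psi_inv_def
    by (simp_all add: f_inv_into_f)
  then show ?thesis
    using Mulholland_less_iff[of "psi_inv \<psi> y" r] assms(2) by auto
qed

text \<open>At negative arguments \<open>\<psi>\<close> is arbitrary and need not be Borel;
  precomposition with \<open>max 0\<close> makes it continuous everywhere and changes nothing at
  distances.\<close>

lemma borel_measurable_Mulholland_dist:
  fixes \<gamma> :: "'a::euclidean_space \<Rightarrow> 'a"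
  assumes "\<gamma> \<in> borel_measurable borel"
  shows "(\<lambda>x. \<psi> (dist x (\<gamma> x))) \<in> borel_measurable borel"
proof -
  have "continuous_on {0..} \<psi>"
    using Mulholland by (simp add: Mulholland_def)
  moreover have "continuous_on UNIV (\<lambda>t::real. max 0 t)"
    by (intro continuous_on_max continuous_on_const continuous_on_id)
  ultimately have "continuous_on UNIV (\<lambda>t. \<psi> (max 0 t))"
    by (rule continuous_on_compose2) auto
  then have [measurable]: "(\<lambda>t. \<psi> (max 0 t)) \<in> borel_measurable borel"
    by (rule borel_measurable_continuous_onI)
  note [measurable] = assms
  have "(\<lambda>x. \<psi> (max 0 (dist x (\<gamma> x)))) \<in> borel_measurable borel"
    by measurable
  then show ?thesis by (simp add: max_def)
qed

lemma AE_transport_map: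
  fixes P Q :: "'a::euclidean_space set"
  assumes P: "region P" and Q: "region Q" and \<gamma>: "\<gamma> \<in> transport_maps P Q"
  shows "AE x in uniform_measure lborel P. x \<in> P \<and> \<gamma> x \<in> Q"
proof -
  have m: "\<gamma> \<in> measurable (uniform_measure lborel P) borel"
    using \<gamma> by (simp add: transport_maps_def cong: measurable_cong_sets)
  have in_self: "AE x in uniform_measure lborel R. x \<in> R" if "region R" for R :: "'a set"
    using region_emeasure[OF that] by (intro AE_uniform_measureI) auto
  have "AE y in distr (uniform_measure lborel P) borel \<gamma>. y \<in> Q"
  proof -
    have "distr (uniform_measure lborel P) borel \<gamma> = uniform_measure lborel Q"
      using \<gamma> by (simp add: transport_maps_def)
    then show ?thesis
      by (simp only: in_self[OF Q])
  qed
  then have "AE x in uniform_measure lborel P. \<gamma> x \<in> Q"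
    using region_emeasure(4)[OF Q] by (subst (asm) AE_distr_iff[OF m]) auto
  then show ?thesis
    using in_self[OF P] by auto
qed

text \<open>Almost surely both \<open>x\<close> and \<open>\<gamma> x\<close> lie in the bounded set
  \<open>P \<union> Q\<close>, which bounds the cost. Thus the Bochner integral is not the default
  value 0.\<close>

lemma integrable_transport_cost:
  fixes P Q :: "'a::euclidean_space set"
  assumes P: "region P" and Q: "region Q" and \<gamma>: "\<gamma> \<in> transport_maps P Q"
  shows "integrable (uniform_measure lborel P) (\<lambda>x. \<psi> (dist x (\<gamma> x)))"
proof -
  interpret prob_space "uniform_measure lborel P"
    by (rule prob_space_uniform_region[OF P])
  have "bounded (P \<union> Q)"
    using P Q by (simp add: region_def)
  then obtain K where K: "\<And>x y. x \<in> P \<union> Q \<Longrightarrow> y \<in> P \<union> Q \<Longrightarrow> dist x y \<le> K"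
    using diameter_bounded_bound by blast
  have "AE x in uniform_measure lborel P. norm (\<psi> (dist x (\<gamma> x))) \<le> \<psi> K"
    using AE_transport_map[OF assms]
  proof eventually_elim
    case (elim x)
    then have "dist x (\<gamma> x) \<le> K"
      using K by blast
    then have "\<psi> (dist x (\<gamma> x)) \<le> \<psi> K"
      using Mulholland_less_iff[of K "dist x (\<gamma> x)"] order_trans[OF zero_le_dist]
      by (meson not_less zero_le_dist)
    then show ?case
      using Mulholland_nonneg[OF zero_le_dist, of x "\<gamma> x"] by simp
  qed
  moreover have "(\<lambda>x. \<psi> (dist x (\<gamma> x))) \<in> borel_measurable (uniform_measure lborel P)"
    using borel_measurable_Mulholland_dist[of \<gamma>] \<gamma> by (simp add: transport_maps_def cong: measurable_cong_sets)
  ultimately show ?thesis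
    by (rule integrable_const_bound)
qed

text \<open>A transport map turns the mean over \<open>Q\<close> into the expectation of
  \<open>w \<circ> \<gamma>\<close> over \<open>P\<close>. Moves of length at most
  \<open>\<epsilon>\<close> change \<open>w\<close> by at most \<open>\<epsilon>\<close>; longer
  ones change it by at most 1, which is at most their cost divided by
  \<open>\<psi> \<epsilon>\<close>.\<close>

lemma mean_diff_le_Wasserstein:
  fixes P Q :: "'a::euclidean_space set" and w :: "'a \<Rightarrow> real"
  assumes P: "region P" and Q: "region Q"
    and w: "\<And>x. 0 \<le> w x" "\<And>x. w x \<le> 1" and lip: "\<And>x y. \<bar>w x - w y\<bar> \<le> dist x y"
    and W: "Wasserstein_dist \<psi> P Q < r" and \<epsilon>: "0 < \<epsilon>"
  shows "integral\<^sup>L (uniform_measure lborel P) w - integral\<^sup>L (uniform_measure lborel Q) w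
    \<le> \<epsilon> + \<psi> r / \<psi> \<epsilon>"
proof -
  let ?U = "uniform_measure lborel P"
  interpret prob_space ?U
    by (rule prob_space_uniform_region[OF P])
  have "continuous_on UNIV w"
    using lip by (intro lipschitz_on_continuous_on[of 1]) (auto simp: lipschitz_on_def dist_real_def)
  then have w_borel: "w \<in> borel_measurable borel"
    by (rule borel_measurable_continuous_onI)
  \<comment> \<open>Existence of transport maps makes the infimum genuine, so one below
    \<open>r\<close> yields a map of cost below \<open>r\<close>.\<close>
  obtain \<gamma> where \<gamma>: "\<gamma> \<in> transport_maps P Q"
    and less: "psi_inv \<psi> ((1 / measure lborel P) * (LINT x:P|lborel. \<psi> (dist x (\<gamma> x)))) < r"
    using W transport_maps_nonempty[OF P Q] unfolding Wasserstein_dist_def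
    by (auto dest: cInf_lessD[rotated])
  have \<gamma>': "\<gamma> \<in> borel_measurable borel" "distr ?U borel \<gamma> = uniform_measure lborel Q"
    using \<gamma> by (auto simp: transport_maps_def)
  let ?h = "\<lambda>x. \<psi> (dist x (\<gamma> x))"
  have h: "integrable ?U ?h"
    by (rule integrable_transport_cost[OF P Q \<gamma>])
  have "psi_inv \<psi> (expectation ?h) < r"
    using less integral_uniform_measure_region[OF P borel_measurable_Mulholland_dist[OF \<gamma>'(1)]] by simp
  then have "expectation ?h < \<psi> r"
    by (intro psi_inv_less_imp integral_nonneg_AE) (auto simp: Mulholland_nonneg)
  have \<psi>\<epsilon>: "0 < \<psi> \<epsilon>"
    using Mulholland_less_iff[of 0 \<epsilon>] \<epsilon> Mulholland by (simp add: Mulholland_def)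
  \<comment> \<open>a Markov-type estimate, which takes the place of the triangle inequality for the distance\<close>
  have pointwise: "w x - w (\<gamma> x) \<le> \<epsilon> + ?h x / \<psi> \<epsilon>" for x
  proof (cases "dist x (\<gamma> x) \<le> \<epsilon>")
    case True
    then show ?thesis
      using lip[of x "\<gamma> x"] \<psi>\<epsilon> Mulholland_nonneg[OF zero_le_dist, of x "\<gamma> x"]
      by (smt (verit) divide_nonneg_pos)
  next
    case False
    then have "\<psi> \<epsilon> \<le> ?h x"
      using Mulholland_less_iff[of \<epsilon> "dist x (\<gamma> x)"] \<epsilon> by auto
    then have "1 \<le> ?h x / \<psi> \<epsilon>"
      using \<psi>\<epsilon> by simp
    then show ?thesis
      using w(1)[of "\<gamma> x"] w(2)[of x] \<epsilon> by linarith
  qed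
  have int: "integrable ?U w" "integrable ?U (\<lambda>x. w (\<gamma> x))"
    using w w_borel \<gamma>'(1) measurable_compose[OF \<gamma>'(1) w_borel]
    by (auto intro!: integrable_const_bound[where B = 1])
  have "integral\<^sup>L (uniform_measure lborel Q) w = expectation (\<lambda>x. w (\<gamma> x))"
    unfolding \<gamma>'(2)[symmetric] using \<gamma>'(1) w_borel by (intro integral_distr) auto
  then have "expectation w - integral\<^sup>L (uniform_measure lborel Q) w
      = expectation (\<lambda>x. w x - w (\<gamma> x))"
    using int by simp
  also have "\<dots> \<le> expectation (\<lambda>x. \<epsilon> + ?h x / \<psi> \<epsilon>)"
    using pointwise int h by (intro integral_mono) auto
  also have "\<dots> = \<epsilon> + expectation ?h / \<psi> \<epsilon>"
    using h prob_space by simp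
  also have "\<dots> \<le> \<epsilon> + \<psi> r / \<psi> \<epsilon>"
    using \<open>expectation ?h < \<psi> r\<close> \<psi>\<epsilon> by (simp add: divide_right_mono)
  finally show ?thesis .
qed

text \<open>This is lower semicontinuity of the mean, so the one-sided estimate suffices.\<close>

lemma openin_Wasserstein_mean_greater:
  fixes w :: "'a::euclidean_space \<Rightarrow> real"
  assumes w: "\<And>x. 0 \<le> w x" "\<And>x. w x \<le> 1" and lip: "\<And>x y. \<bar>w x - w y\<bar> \<le> dist x y"
  shows "openin (dist_topology star_regions (Wasserstein_dist \<psi>))
    {P \<in> star_regions. c < integral\<^sup>L (uniform_measure lborel P) w}"
  unfolding openin_dist_topology
proof safe
  fix P :: "'a set"
  assume P: "P \<in> star_regions" and c: "c < integral\<^sup>L (uniform_measure lborel P) w"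
  \<comment> \<open>The mean can drop by at most \<open>2 * \<eta>\<close> out of a gap of
    \<open>3 * \<eta>\<close>.\<close>
  define \<eta> where "\<eta> = (integral\<^sup>L (uniform_measure lborel P) w - c) / 3"
  have "0 < \<eta>" unfolding \<eta>_def using c by simp
  have \<psi>0: "\<psi> 0 = 0"
    using Mulholland by (simp add: Mulholland_def)
  have \<psi>\<eta>: "0 < \<psi> \<eta>"
    using Mulholland_less_iff[of 0 \<eta>] \<open>0 < \<eta>\<close> \<psi>0 by simp
  \<comment> \<open>This \<open>r\<close> makes the error term
    \<open>\<psi> r / \<psi> \<eta>\<close> equal to \<open>\<eta>\<close>.\<close>
  obtain r where r: "0 \<le> r" "\<psi> r = \<psi> \<eta> * \<eta>"
    using Mulholland_surj[of "\<psi> \<eta> * \<eta>"] \<psi>\<eta> \<open>0 < \<eta>\<close> by auto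
  have "0 < r"
    using r \<psi>0 \<psi>\<eta> \<open>0 < \<eta>\<close> by (cases "r = 0") auto
  show "\<exists>r>0. \<forall>Q\<in>star_regions. Wasserstein_dist \<psi> P Q < r \<longrightarrow>
      Q \<in> {P \<in> star_regions. c < integral\<^sup>L (uniform_measure lborel P) w}"
  proof (intro exI[of _ r] conjI ballI impI)
    fix Q assume Q: "Q \<in> star_regions" "Wasserstein_dist \<psi> P Q < r"
    have "integral\<^sup>L (uniform_measure lborel P) w - integral\<^sup>L (uniform_measure lborel Q) w
        \<le> \<eta> + \<psi> r / \<psi> \<eta>"
      using P Q \<open>0 < \<eta>\<close> by (intro mean_diff_le_Wasserstein w lip) (auto simp: region_if_star_region)
    also have "\<dots> = 2 * \<eta>"
      using r \<psi>\<eta> by simp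
    finally show "Q \<in> {P \<in> star_regions. c < integral\<^sup>L (uniform_measure lborel P) w}"
      using Q \<open>0 < \<eta>\<close> unfolding \<eta>_def by (simp add: field_simps)
  qed fact
qed

end

section \<open>Comparison with the Hausdorff topology\<close>

text \<open>A criterion common to both claims: every Hausdorff ball about the unit ball contains a
  spiky region, which by \<open>out\<close> is missing from \<open>U\<close>.\<close>

lemma Hausdorff_not_finerI:
  fixes c :: real and U :: "'a::euclidean_space set set"
  assumes dim: "2 \<le> DIM('a)"
    and U: "openin (dist_topology star_regions d) U" "ball 0 1 \<in> U" and "0 < c"
    and out: "\<And>Q. Q \<in> star_regions \<Longrightarrow> ball 0 (1/2) \<subseteq> Q \<Longrightarrow>
      measure lborel (Q - cball 0 (1/2)) < c \<Longrightarrow> Q \<notin> U"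
  shows "\<not> finer_than (dist_topology star_regions Hausdorff_dist) (dist_topology star_regions d)"
proof
  assume "finer_than (dist_topology star_regions Hausdorff_dist) (dist_topology star_regions d)"
  then have "openin (dist_topology star_regions Hausdorff_dist) U"
    using U(1) by (simp add: finer_than_def)
  then obtain r where r: "0 < r" "\<And>Q. Q \<in> star_regions \<Longrightarrow> Hausdorff_dist (ball 0 1) Q < r \<Longrightarrow> Q \<in> U"
    using U(2) unfolding openin_dist_topology by blast
  \<comment> \<open>One parameter serves both demands: volume below \<open>c\<close> outside the
    half ball, and Hausdorff distance at most \<open>r / 2\<close>, strictly below
    \<open>r\<close>.\<close>
  obtain Q :: "'a set" where "Q \<in> star_regions" "Hausdorff_dist (ball 0 1) Q \<le> min c (r / 2)"
    "ball 0 (1/2) \<subseteq> Q" "measure lborel (Q - cball 0 (1/2)) < min c (r / 2)"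
    using spiky_star_region[OF dim, of "min c (r / 2)"] r(1) \<open>0 < c\<close> by auto
  then show False
    using r out[of Q] by auto
qed

theorem theorem17:
  assumes "2 \<le> DIM('a::euclidean_space)"
  shows "\<not> finer_than (dist_topology (star_regions :: 'a set set) Hausdorff_dist)
                      (dist_topology star_regions sym_diff_dist)
         \<and> (\<forall>\<psi>. Mulholland \<psi> \<longrightarrow>
              \<not> finer_than (dist_topology (star_regions :: 'a set set) Hausdorff_dist)
                           (dist_topology star_regions (Wasserstein_dist \<psi>)))"
proof (intro conjI allI impI)
  let ?B = "ball (0::'a) 1"
  have B: "?B \<in> star_regions"
    by (rule ball_in_star_regions) simp
  have shell: "0 < measure lborel (?B - cball 0 r)" if "0 \<le> r" "r < 1" for r
    using that by (intro measure_open_pos ball_minus_cball_ne) auto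
  show "\<not> finer_than (dist_topology (star_regions :: 'a set set) Hausdorff_dist)
      (dist_topology star_regions sym_diff_dist)"
  proof -
    define c where "c = measure lborel (?B - cball 0 (1/2)) / 2"
    have "0 < c" unfolding c_def using shell[of "1/2"] by simp
    show ?thesis
    proof (rule Hausdorff_not_finerI[OF assms openin_sym_diff_ball[OF B, of c] _ \<open>0 < c\<close>])
      show "?B \<in> {Q \<in> star_regions. sym_diff_dist ?B Q < c}"
        using B \<open>0 < c\<close> by (simp add: sym_diff_dist_def)
      fix Q :: "'a set"
      assume Q: "Q \<in> star_regions" "measure lborel (Q - cball 0 (1/2)) < c"
      have "R \<in> fmeasurable lborel" "R \<in> sets borel" if "R \<in> star_regions" for R :: "'a set"
        using region_emeasure(2,4)[OF region_if_star_region[OF that]]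
        by (auto intro!: fmeasurableI simp: less_top)
      note fm = this[OF B] this[OF Q(1)]
      \<comment> \<open>A point of the shell of volume \<open>2 * c\<close> either lies outside
        \<open>Q\<close>, hence in the symmetric difference, or in \<open>Q - cball 0 (1/2)\<close>,
        whose volume is below \<open>c\<close>.\<close>
      have "2 * c \<le> measure lborel ((?B - Q \<union> (Q - ?B)) \<union> (Q - cball 0 (1/2)))"
        unfolding c_def using fm
        by (simp, intro measure_mono_fmeasurable) (auto intro!: fmeasurable.Un fmeasurable.Diff fmeasurable_Diff)
      also have "\<dots> \<le> sym_diff_dist ?B Q + measure lborel (Q - cball 0 (1/2))"
        unfolding sym_diff_dist_def using fm by (intro measure_Un_le) auto
      finally show "Q \<notin> {Q \<in> star_regions. sym_diff_dist ?B Q < c}"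
        using Q(2) by auto
    qed
  qed
  fix \<psi> assume \<psi>: "Mulholland \<psi>"
  \<comment> \<open>Truncating \<open>norm x - 1/2\<close> keeps the Lipschitz constant 1, gives
    values in [0,1] and makes \<open>w\<close> vanish on the closed half ball.\<close>
  define w :: "'a \<Rightarrow> real" where "w x = max 0 (min 1 (norm x - 1/2))" for x
  have w: "0 \<le> w x" "w x \<le> 1" for x
    unfolding w_def by auto
  have lip: "\<bar>w x - w y\<bar> \<le> dist x y" for x y
    unfolding w_def dist_norm using norm_triangle_ineq3[of x y] by (auto simp: max_def min_def)
  have w_borel: "w \<in> borel_measurable borel"
    unfolding w_def by measurable
  let ?mean = "\<lambda>P. integral\<^sup>L (uniform_measure lborel P) w"
  have int: "integrable (uniform_measure lborel P) w" if "P \<in> star_regions" for P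
  proof -
    interpret prob_space "uniform_measure lborel P"
      by (rule prob_space_uniform_region[OF region_if_star_region[OF that]])
    show ?thesis
      using w w_borel by (intro integrable_const_bound[where B = 1]) auto
  qed
  have mass: "integral\<^sup>L (uniform_measure lborel P) (indicator (- cball 0 r))
      = measure lborel (P - cball 0 r) / measure lborel P"
    and int_ind: "integrable (uniform_measure lborel P) (indicator (- cball 0 r) :: 'a \<Rightarrow> real)"
    if "P \<in> star_regions" for P :: "'a set" and r
  proof -
    have P: "region P" using that by (rule region_if_star_region)
    interpret prob_space "uniform_measure lborel P"
      by (rule prob_space_uniform_region[OF P])
    show "integrable (uniform_measure lborel P) (indicator (- cball 0 r) :: 'a \<Rightarrow> real)"
      by (intro integrable_const_bound[where B = 1]) auto
    show "integral\<^sup>L (uniform_measure lborel P) (indicator (- cball 0 r))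
      = measure lborel (P - cball 0 r) / measure lborel P"
      using region_emeasure[OF P] by (simp add: Diff_eq)
  qed
  define c where "c = ?mean ?B / 2"
  \<comment> \<open>The mean over the unit ball is positive because \<open>w\<close> is at least 1/4
    outside radius 3/4, where the ball still has volume.\<close>
  have "0 < (1/4) * (measure lborel (?B - cball 0 (3/4)) / measure lborel ?B)"
    using shell[of "3/4"] region_emeasure(3)[OF region_if_star_region[OF B]] by simp
  also have "\<dots> = (LINT x|uniform_measure lborel ?B. (1/4) * indicator (- cball 0 (3/4)) x)"
    by (subst integral_mult_right_zero) (simp only: mass[OF B])
  also have "\<dots> \<le> ?mean ?B"
  proof (rule integral_mono)
    show "(1/4) * indicator (- cball 0 (3/4)) x \<le> w x" for x
      by (cases "x \<in> cball 0 (3/4)") (auto simp: w_def max_def min_def)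
  qed (use int[OF B] int_ind[OF B] in auto)
  finally have "0 < c" unfolding c_def by simp
  show "\<not> finer_than (dist_topology (star_regions :: 'a set set) Hausdorff_dist)
      (dist_topology star_regions (Wasserstein_dist \<psi>))"
  proof (rule Hausdorff_not_finerI[OF assms openin_Wasserstein_mean_greater[OF \<psi> w lip, of c]])
    show "?B \<in> {P \<in> star_regions. c < ?mean P}"
      using B \<open>0 < c\<close> unfolding c_def by simp
    let ?half = "ball (0::'a) (1/2)"
    have half: "0 < measure lborel ?half"
      by (intro measure_open_pos) auto
    \<comment> \<open>Since \<open>Q\<close> contains the half ball, this threshold makes the
      fraction of \<open>Q\<close> outside the closed half ball at most \<open>c\<close>; that
      fraction bounds the mean of \<open>w\<close>.\<close>
    then show "0 < c * measure lborel ?half"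
      using \<open>0 < c\<close> by simp
    fix Q :: "'a set"
    assume Q: "Q \<in> star_regions" "?half \<subseteq> Q"
      "measure lborel (Q - cball 0 (1/2)) < c * measure lborel ?half"
    have pos: "0 < measure lborel Q"
      by (rule region_emeasure(3)[OF region_if_star_region[OF Q(1)]])
    have "measure lborel ?half \<le> measure lborel Q"
      using Q(2) region_emeasure(2,4)[OF region_if_star_region[OF Q(1)]]
      by (intro measure_mono_fmeasurable) (auto intro!: fmeasurableI simp: less_top)
    then have le: "c * measure lborel ?half \<le> c * measure lborel Q"
      using \<open>0 < c\<close> by simp
    have "?mean Q \<le> integral\<^sup>L (uniform_measure lborel Q) (indicator (- cball 0 (1/2)))"
      using int[OF Q(1)] int_ind[OF Q(1)]
      by (intro integral_mono) (auto simp: w_def indicator_def)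
    also have "\<dots> \<le> c"
      unfolding mass[OF Q(1)] using Q(3) le pos by (simp add: divide_le_eq)
    finally show "Q \<notin> {P \<in> star_regions. c < ?mean P}"
      by simp
  qed
qed

end
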